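(* Let $G=(V,E)$ be a water distribution system with reservoir nodes $V_{\mathrm r}$ and consumer nodes $V_{\mathrm c}$, and let reservoir heads $h_{V_{\mathrm r}}\in\mathbb{R}^{V_{\mathrm r}}$ and flows $q\in\mathbb{R}^{E}$ be given. If $$D(q)\,q-B_{V_{\mathrm r}\cdot}^{T}h_{V_{\mathrm r}}\in\operatorname{im}\bigl(B_{V_{\mathrm c}\cdot}^{T}\bigr)\subset\mathbb{R}^{E},$$ then there exists exactly one pair $(h_{V_{\mathrm c}},d)$ of consumer heads $h_{V_{\mathrm c}}\in\mathbb{R}^{V_{\mathrm c}}$ and demands $d\in\mathbb{R}^{V_{\mathrm c}}$ such that the triple $(h,q,d)$, where $h\in\mathbb{R}^V$ is the vector with restrictions $h_{V_{\mathrm r}}$ to $V_{\mathrm r}$ and $h_{V_{\mathrm c}}$ to $V_{\mathrm c}$, is physically correct.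
   Context: A water distribution system (WDS) is a finite, connected, symmetric directed graph $G=(V,E)$ with $V\neq\emptyset$, $E\neq\emptyset$, whose edges are ordered pairs of distinct nodes; $e_{vu}=(v,u)$ denotes the edge from $v$ to $u$, and symmetric means $e_{vu}\in E$ implies $e_{uv}\in E$. The node set is a disjoint union $V=V_{\mathrm r}\sqcup V_{\mathrm c}$ of a nonempty set $V_{\mathrm r}$ of reservoir nodes and a nonempty set $V_{\mathrm c}$ of consumer nodes. The neighborhood of $v$ is $\mathcal N(v)=\{u\in V: e_{vu}\in E \text{ or } e_{uv}\in E\}$. Each edge carries a resistance coefficient $r_{vu}=10.67\, l_{vu}\,\rho_{vu}^{-4.8704}\,\eta_{vu}^{-1.852}>0$, where the length $l_{vu}=l_{uv}>0$, diameter $\rho_{vu}=\rho_{uv}>0$ and roughness $\eta_{vu}=\eta_{uv}>0$ are symmetric (so $r_{vu}=r_{uv}$), and $x=1.852$. A hydraulic state is a triple $(h,q,d)$ of heads $h=(h_v)_{v\in V}$, flows $q=(q_e)_{e\in E}$ (write $q_{vu}=q_{e_{vu}}$) and demands $d=(d_v)_{v\in V_{\mathrm c}}$; all entries are real numbers. It is called physically correct if and only if the following three conditions hold: (1) conservation of energy: $h_v-h_u=r_{vu}\,q_{vu}\,|q_{vu}|^{x-1}$ for all $v\in V$, $u\in\mathcal N(v)$; (2) conservation of mass: $\sum_{u\in\mathcal N(v)}q_{vu}=-d_v$ for all $v\in V_{\mathrm c}$; (3) conservation of flows: $q_{uv}=-q_{vu}$ for all $v\in V$, $u\in\mathcal N(v)$.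 The incidence matrix $B\in\mathbb{R}^{V\times E}$ has entry $1$ at $(v,e)$ if $e=e_{vu}$ for some $u$, entry $-1$ if $e=e_{uv}$ for some $u$, and $0$ otherwise. For $S\subset V$, $B_{S\cdot}\in\mathbb{R}^{S\times E}$ is the submatrix of the rows indexed by $S$. $D(q)\in\mathbb{R}^{E\times E}$ is the diagonal matrix with diagonal entries $r_e|q_e|^{x-1}$, $e\in E$. *)

theory Defs
  imports
    "HOL-Analysis.Finite_Product_Measure"
    "Graph_Theory.Pair_Digraph"
    "Graph_Theory.Digraph_Component"
begin

section \<open>Vectors and matrices indexed by finite sets\<close>

text \<open>
  An element of \<open>\<real>\<^sup>I\<close> is an extensional function on \<open>I\<close> (it is \<open>undefined\<close> outside \<open>I\<close>), so that
  equality of functions is equality of vectors. Likewise a matrix in \<open>\<real>\<^sup>I\<^sup>\<times>\<^sup>J\<close> is an element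
  of \<open>I \<rightarrow>\<^sub>E vecs J\<close>; its row submatrix for \<open>S \<subseteq> I\<close> is \<open>restrict A S\<close>.
\<close>

abbreviation vecs :: "'i set \<Rightarrow> ('i \<Rightarrow> real) set" where
  "vecs I \<equiv> I \<rightarrow>\<^sub>E (UNIV :: real set)"

definition vec_diff :: "'i set \<Rightarrow> ('i \<Rightarrow> real) \<Rightarrow> ('i \<Rightarrow> real) \<Rightarrow> 'i \<Rightarrow> real" where
  "vec_diff I x y = (\<lambda>i\<in>I. x i - y i)"

definition mat_transpose :: "'i set \<Rightarrow> 'j set \<Rightarrow> ('i \<Rightarrow> 'j \<Rightarrow> real) \<Rightarrow> 'j \<Rightarrow> 'i \<Rightarrow> real" where
  "mat_transpose I J A = (\<lambda>j\<in>J. \<lambda>i\<in>I. A i j)"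

definition mat_vec :: "'i set \<Rightarrow> 'j set \<Rightarrow> ('i \<Rightarrow> 'j \<Rightarrow> real) \<Rightarrow> ('j \<Rightarrow> real) \<Rightarrow> 'i \<Rightarrow> real" where
  "mat_vec I J A x = (\<lambda>i\<in>I. \<Sum>j\<in>J. A i j * x j)"

definition mat_im :: "'i set \<Rightarrow> 'j set \<Rightarrow> ('i \<Rightarrow> 'j \<Rightarrow> real) \<Rightarrow> ('i \<Rightarrow> real) set" where
  "mat_im I J A = mat_vec I J A ` vecs J"

section \<open>Water distribution systems\<close>

text \<open>
  Edge data are functions on ordered pairs of nodes; only their values on \<open>parcs G\<close> matter.
  The locale \<^locale>\<open>pair_graph\<close> provides finiteness, symmetry and absence of loops. The
  qualified name avoids the topological notion of connectedness.
\<close>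

locale water_distribution_system = pair_graph G
  for G :: "'v pair_pre_digraph" +
  fixes Vr Vc :: "'v set"
    and len diam rough :: "'v \<times> 'v \<Rightarrow> real"
  assumes connected: "Digraph_Component.connected (with_proj G)"
    and nodes_nonempty: "pverts G \<noteq> {}"
    and edges_nonempty: "parcs G \<noteq> {}"
    and nodes_partition: "pverts G = Vr \<union> Vc" "Vr \<inter> Vc = {}"
    and reservoirs_nonempty: "Vr \<noteq> {}"
    and consumers_nonempty: "Vc \<noteq> {}"
    and len_pos: "\<And>e. e \<in> parcs G \<Longrightarrow> len e > 0"
    and len_sym: "\<And>v u. (v, u) \<in> parcs G \<Longrightarrow> len (v, u) = len (u, v)"
    and diam_pos: "\<And>e. e \<in> parcs G \<Longrightarrow> diam e > 0"
    and diam_sym: "\<And>v u. (v, u) \<in> parcs G \<Longrightarrow> diam (v, u) = diam (u, v)"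
    and rough_pos: "\<And>e. e \<in> parcs G \<Longrightarrow> rough e > 0"
    and rough_sym: "\<And>v u. (v, u) \<in> parcs G \<Longrightarrow> rough (v, u) = rough (u, v)"

definition neighborhood :: "'v pair_pre_digraph \<Rightarrow> 'v \<Rightarrow> 'v set" where
  "neighborhood G v = {u \<in> pverts G. (v, u) \<in> parcs G \<or> (u, v) \<in> parcs G}"

definition flow_exponent :: real where
  "flow_exponent = 1.852"

definition resistance ::
  "('v \<times> 'v \<Rightarrow> real) \<Rightarrow> ('v \<times> 'v \<Rightarrow> real) \<Rightarrow> ('v \<times> 'v \<Rightarrow> real) \<Rightarrow> 'v \<times> 'v \<Rightarrow> real" where
  "resistance len diam rough e =
     10.67 * len e * diam e powr (- 4.8704) * rough e powr (- 1.852)"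

text \<open>
  A hydraulic state is a triple \<open>(h, q, d)\<close> in
  \<open>vecs (pverts G) \<times> vecs (parcs G) \<times> vecs Vc\<close>; the argument \<open>r\<close> is the resistance function.
  Note that \<open>0 powr a = 0\<close>, which is the intended value of \<open>\<bar>0\<bar>\<close> to the positive
  power \<open>flow_exponent - 1\<close>.
\<close>

definition physically_correct ::
  "'v pair_pre_digraph \<Rightarrow> 'v set \<Rightarrow> ('v \<times> 'v \<Rightarrow> real) \<Rightarrow>
   ('v \<Rightarrow> real) \<times> ('v \<times> 'v \<Rightarrow> real) \<times> ('v \<Rightarrow> real) \<Rightarrow> bool" where
  "physically_correct G Vc r = (\<lambda>(h, q, d).
     (\<forall>v\<in>pverts G. \<forall>u\<in>neighborhood G v.
        h v - h u = r (v, u) * q (v, u) * \<bar>q (v, u)\<bar> powr (flow_exponent - 1)) \<and>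
     (\<forall>v\<in>Vc. (\<Sum>u\<in>neighborhood G v. q (v, u)) = - d v) \<and>
     (\<forall>v\<in>pverts G. \<forall>u\<in>neighborhood G v. q (u, v) = - q (v, u)))"

definition incidence_matrix :: "'v pair_pre_digraph \<Rightarrow> 'v \<Rightarrow> 'v \<times> 'v \<Rightarrow> real" where
  "incidence_matrix G = (\<lambda>v\<in>pverts G. \<lambda>e\<in>parcs G.
     if \<exists>u. e = (v, u) then 1 else if \<exists>u. e = (u, v) then - 1 else 0)"

definition resistance_matrix ::
  "'v pair_pre_digraph \<Rightarrow> ('v \<times> 'v \<Rightarrow> real) \<Rightarrow> ('v \<times> 'v \<Rightarrow> real) \<Rightarrow>
   'v \<times> 'v \<Rightarrow> 'v \<times> 'v \<Rightarrow> real" where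
  "resistance_matrix G r q = (\<lambda>e\<in>parcs G. \<lambda>e'\<in>parcs G.
     if e = e' then r e * \<bar>q e\<bar> powr (flow_exponent - 1) else 0)"

definition incidence_rows_transpose ::
  "'v pair_pre_digraph \<Rightarrow> 'v set \<Rightarrow> 'v \<times> 'v \<Rightarrow> 'v \<Rightarrow> real" where
  "incidence_rows_transpose G S =
     mat_transpose S (parcs G) (restrict (incidence_matrix G) S)"

end

theory Submission
  imports Defs
begin

text \<open>
  The transposed incidence matrix sends a head vector to its drops \<open>h v - h u\<close> along the edges
  (lemma \<open>mat_vec_incidence_rows_transpose\<close>). The hypothesis on the image therefore says that there
  are consumer heads for which conservation of energy holds with the given flows: splitting the
  incidence matrix into reservoir and consumer rows splits the drop \<open>h v - h u\<close> into the
  contributions of the fixed and of the free heads (lemma \<open>energy_iff_vec_diff_eq\<close>).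

  Conservation of flows is a consequence of conservation of energy. The two orientations of an edge
  have opposite head drops and the same resistance, and \<open>t \<mapsto> t \<bar>t\<bar>\<^sup>p\<close> is odd and injective
  (lemma \<open>energy_imp_flow_antisym\<close>). Conservation of mass imposes nothing on \<open>q\<close>; it is a formula
  for the demand \<open>d\<close>.

  The demand is thus unique. For the heads, two solutions for the same \<open>q\<close> have the same drops, so
  their difference is constant along edges, hence constant on the connected graph, and it vanishes
  at any reservoir (lemma \<open>heads_unique\<close>).
\<close>

text \<open>
  The function \<open>t \<mapsto> t \<bar>t\<bar>\<^sup>p\<close> keeps the sign of \<open>t\<close> and raises its absolute value to the power
  \<open>p + 1 > 0\<close>, so both sign and absolute value of \<open>t\<close> can be recovered.
\<close>

lemma mult_abs_powr_cancel:
  fixes s t p :: real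
  assumes "p \<ge> 0" and eq: "s * \<bar>s\<bar> powr p = t * \<bar>t\<bar> powr p"
  shows "s = t"
proof -
  have abs: "\<bar>y * \<bar>y\<bar> powr p\<bar> = \<bar>y\<bar> powr (p + 1)" and sgn: "sgn (y * \<bar>y\<bar> powr p) = sgn y"
    for y :: real
    by (cases "y = 0"; simp add: abs_mult powr_add sgn_mult)+
  have "\<bar>s\<bar> powr (p + 1) = \<bar>t\<bar> powr (p + 1)"
    using eq abs by metis
  then have "\<bar>s\<bar> = \<bar>t\<bar>"
    using powr_inj[of "p + 1" "\<bar>s\<bar>" "\<bar>t\<bar>"] powr_less_mono2[of "p + 1"] \<open>p \<ge> 0\<close>
    by (metis abs_ge_zero add_nonneg_pos linorder_neqE_linordered_idom order_less_irrefl zero_less_one)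
  moreover have "sgn s = sgn t"
    using eq sgn by metis
  ultimately show ?thesis
    by (metis abs_mult_sgn)
qed

lemma mat_vec_resistance_matrix:
  assumes "finite (parcs G)" and "e \<in> parcs G"
  shows "mat_vec (parcs G) (parcs G) (resistance_matrix G r q) q e =
    r e * q e * \<bar>q e\<bar> powr (flow_exponent - 1)"
proof -
  have "(\<Sum>e'\<in>parcs G. resistance_matrix G r q e e' * q e') =
      (\<Sum>e'\<in>parcs G. if e = e' then r e * \<bar>q e\<bar> powr (flow_exponent - 1) * q e else 0)"
    using assms by (intro sum.cong) (auto simp: resistance_matrix_def)
  then show ?thesis
    using assms by (simp add: mat_vec_def)
qed

text \<open>
  The row of the transposed incidence matrix at \<open>(v, u)\<close> has only the entries \<open>1\<close> at \<open>v\<close> and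
  \<open>- 1\<close> at \<open>u\<close>. A loop would break this, because the incidence matrix assigns it the entry \<open>1\<close>
  alone; hence the assumption \<open>v \<noteq> u\<close>.
\<close>

lemma mat_vec_incidence_rows_transpose:
  assumes "finite S" and "S \<subseteq> pverts G" and "(v, u) \<in> parcs G" and "v \<noteq> u"
  shows "mat_vec (parcs G) S (incidence_rows_transpose G S) x (v, u) =
    (if v \<in> S then x v else 0) - (if u \<in> S then x u else 0)"
proof -
  have "(\<Sum>w\<in>S. incidence_rows_transpose G S (v, u) w * x w) =
      (\<Sum>w\<in>S. (if v = w then x v else 0) - (if u = w then x u else 0))"
    using assms
    by (intro sum.cong)
       (auto simp: incidence_rows_transpose_def mat_transpose_def incidence_matrix_def subset_iff)
  also have "\<dots> = (if v \<in> S then x v else 0) - (if u \<in> S then x u else 0)"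
    using \<open>finite S\<close> by (simp add: sum_subtractf)
  finally show ?thesis
    using assms by (simp add: mat_vec_def)
qed

lemma (in pair_sym_digraph) connected_imp_constant:
  assumes conn: "Digraph_Component.connected (with_proj G)"
    and step: "\<And>a b. (a, b) \<in> parcs G \<Longrightarrow> f a = f b"
    and "v \<in> pverts G" and "u \<in> pverts G"
  shows "f v = f u"
proof -
  have "v \<rightarrow>\<^sup>*\<^bsub>with_proj G\<^esub> u"
    using symmetric_connected_imp_strongly_connected[OF sym_arcs conn] assms(3,4)
    by (auto simp: strongly_connected_def)
  then show ?thesis
    by (induction rule: reachable_induct) (auto simp: arcs_ends_def arc_to_ends_def step)
qed

context water_distribution_system
begin

lemma mem_neighborhood_iff: "u \<in> neighborhood G v \<longleftrightarrow> (v, u) \<in> parcs G"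
  using arcs_symmetric in_arcsD1 in_arcsD2 by (auto simp: neighborhood_def)

lemma ball_neighborhood_iff:
  "(\<forall>v\<in>pverts G. \<forall>u\<in>neighborhood G v. P v u) \<longleftrightarrow> (\<forall>(v, u)\<in>parcs G. P v u)"
  using in_arcsD1 by (fastforce simp: mem_neighborhood_iff)

lemma resistance_pos: "e \<in> parcs G \<Longrightarrow> resistance len diam rough e > 0"
  using len_pos[of e] diam_pos[of e] rough_pos[of e] by (simp add: resistance_def)

lemma resistance_sym:
  "(v, u) \<in> parcs G \<Longrightarrow> resistance len diam rough (u, v) = resistance len diam rough (v, u)"
  by (simp add: resistance_def len_sym diam_sym rough_sym)

definition energy_conserved :: "('v \<Rightarrow> real) \<Rightarrow> ('v \<times> 'v \<Rightarrow> real) \<Rightarrow> bool" where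
  "energy_conserved h q \<longleftrightarrow> (\<forall>(v, u)\<in>parcs G.
     h v - h u = resistance len diam rough (v, u) * q (v, u) * \<bar>q (v, u)\<bar> powr (flow_exponent - 1))"

text \<open>
  Conservation of energy on both orientations of an edge gives head losses that sum to zero. After
  dividing by the common resistance, \<open>q (u, v)\<close> and \<open>- q (v, u)\<close> have the same image under the
  injective odd function \<open>t \<mapsto> t \<bar>t\<bar>\<^sup>p\<close>.
\<close>

lemma energy_imp_flow_antisym:
  assumes energy: "energy_conserved h q" and e: "(v, u) \<in> parcs G"
  shows "q (u, v) = - q (v, u)"
proof -
  let ?r = "resistance len diam rough (v, u)" and ?p = "flow_exponent - 1"
  have e': "(u, v) \<in> parcs G"
    using e arcs_symmetric by simp
  have "h v - h u = ?r * q (v, u) * \<bar>q (v, u)\<bar> powr ?p"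
    and "h u - h v = ?r * q (u, v) * \<bar>q (u, v)\<bar> powr ?p"
    using energy e e' resistance_sym[OF e] by (force simp: energy_conserved_def)+
  then have "?r * (q (u, v) * \<bar>q (u, v)\<bar> powr ?p) = ?r * (- q (v, u) * \<bar>- q (v, u)\<bar> powr ?p)"
    by (simp add: algebra_simps)
  then have "q (u, v) * \<bar>q (u, v)\<bar> powr ?p = - q (v, u) * \<bar>- q (v, u)\<bar> powr ?p"
    using resistance_pos[OF e] by (simp only: mult_cancel_left) simp
  then show ?thesis
    by (rule mult_abs_powr_cancel[rotated]) (simp add: flow_exponent_def)
qed

text \<open>
  Once energy is conserved, flow conservation is automatic and mass conservation reads as a
  definition of the demand.
\<close>

lemma physically_correct_iff:
  assumes "d \<in> vecs Vc"
  shows "physically_correct G Vc (resistance len diam rough) (h, q, d) \<longleftrightarrow>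
    energy_conserved h q \<and> d = (\<lambda>v\<in>Vc. - (\<Sum>u\<in>neighborhood G v. q (v, u)))"
proof -
  have mass: "(\<forall>v\<in>Vc. (\<Sum>u\<in>neighborhood G v. q (v, u)) = - d v) \<longleftrightarrow>
      d = (\<lambda>v\<in>Vc. - (\<Sum>u\<in>neighborhood G v. q (v, u)))"
    using assms by (auto simp: fun_eq_iff restrict_def PiE_def extensional_def)
  show ?thesis
    using energy_imp_flow_antisym
    unfolding physically_correct_def prod.case mass ball_neighborhood_iff
      energy_conserved_def[symmetric]
    by blast
qed

text \<open>
  Splitting the rows of the incidence matrix into reservoirs and consumers turns conservation of
  energy into a linear system for the consumer heads alone.
\<close>

lemma energy_iff_vec_diff_eq:
  "energy_conserved (merge Vr Vc (hr, hc)) q \<longleftrightarrow>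
    vec_diff (parcs G)
      (mat_vec (parcs G) (parcs G) (resistance_matrix G (resistance len diam rough) q) q)
      (mat_vec (parcs G) Vr (incidence_rows_transpose G Vr) hr) =
    mat_vec (parcs G) Vc (incidence_rows_transpose G Vc) hc"
  (is "_ \<longleftrightarrow> vec_diff _ ?Dq ?Br = ?Bc")
proof -
  have drop: "merge Vr Vc (hr, hc) v - merge Vr Vc (hr, hc) u = ?Br (v, u) + ?Bc (v, u)"
    if e: "(v, u) \<in> parcs G" for v u
  proof -
    have fin: "finite Vr" "finite Vc" and sub: "Vr \<subseteq> pverts G" "Vc \<subseteq> pverts G"
      using pair_finite_verts nodes_partition by auto
    have ends: "v \<in> Vr \<union> Vc" "u \<in> Vr \<union> Vc"
      using in_arcsD1[OF e] in_arcsD2[OF e] nodes_partition by auto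
    have "v \<noteq> u"
      using no_loops[OF e] by simp
    note B = mat_vec_incidence_rows_transpose[OF _ _ e this]
    show ?thesis
      using ends nodes_partition(2)
      by (auto simp: B[OF fin(1) sub(1)] B[OF fin(2) sub(2)] merge_def)
  qed
  have "energy_conserved (merge Vr Vc (hr, hc)) q \<longleftrightarrow>
      (\<forall>(v, u)\<in>parcs G. ?Br (v, u) + ?Bc (v, u) = ?Dq (v, u))"
    unfolding energy_conserved_def
    by (intro ball_cong)
       (auto simp: drop mat_vec_resistance_matrix[OF pair_finite_arcs])
  also have "\<dots> \<longleftrightarrow> (\<forall>e\<in>parcs G. vec_diff (parcs G) ?Dq ?Br e = ?Bc e)"
    by (intro ball_cong) (auto simp: vec_diff_def)
  also have "\<dots> \<longleftrightarrow> vec_diff (parcs G) ?Dq ?Br = ?Bc"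
    by (auto simp: fun_eq_iff vec_diff_def mat_vec_def)
  finally show ?thesis .
qed

text \<open>
  The flows fix the drop along every edge, so \<open>h - h'\<close> is constant on the connected graph; the
  reservoir \<open>w\<close> fixes that constant to be zero.
\<close>

lemma heads_unique:
  assumes "energy_conserved h q" and "energy_conserved h' q"
    and "w \<in> Vr" and "h w = h' w" and "v \<in> pverts G"
  shows "h v = h' v"
proof -
  have "h a - h' a = h b - h' b" if "(a, b) \<in> parcs G" for a b
    using assms(1,2) that by (force simp: energy_conserved_def)
  moreover have "w \<in> pverts G"
    using \<open>w \<in> Vr\<close> nodes_partition by auto
  ultimately have "h v - h' v = h w - h' w"
    using connected_imp_constant[OF connected, of "\<lambda>a. h a - h' a"] \<open>v \<in> pverts G\<close> by blast
  then show ?thesis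
    using \<open>h w = h' w\<close> by simp
qed

lemma consumer_heads_unique:
  assumes "energy_conserved (merge Vr Vc (hr, hc)) q" and "energy_conserved (merge Vr Vc (hr, hc')) q"
    and "hc \<in> vecs Vc" and "hc' \<in> vecs Vc"
  shows "hc = hc'"
proof (rule PiE_ext[OF assms(3,4)])
  fix v assume v: "v \<in> Vc"
  obtain w where w: "w \<in> Vr"
    using reservoirs_nonempty by blast
  have "merge Vr Vc (hr, hc) v = merge Vr Vc (hr, hc') v"
    by (rule heads_unique[OF assms(1,2) w])
      (use w v nodes_partition in \<open>auto simp: merge_def\<close>)
  then show "hc v = hc' v"
    using v nodes_partition by (auto simp: merge_def split: if_splits)
qed

end

theorem theorem3p22:
  fixes G :: "'v pair_pre_digraph"
    and Vr Vc :: "'v set"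
    and len diam rough :: "'v \<times> 'v \<Rightarrow> real"
    and hr :: "'v \<Rightarrow> real"
    and q :: "'v \<times> 'v \<Rightarrow> real"
  assumes "water_distribution_system G Vr Vc len diam rough"
    and "hr \<in> vecs Vr"
    and "q \<in> vecs (parcs G)"
    and "vec_diff (parcs G)
           (mat_vec (parcs G) (parcs G)
              (resistance_matrix G (resistance len diam rough) q) q)
           (mat_vec (parcs G) Vr (incidence_rows_transpose G Vr) hr)
         \<in> mat_im (parcs G) Vc (incidence_rows_transpose G Vc)"
  shows "\<exists>!p. p \<in> vecs Vc \<times> vecs Vc \<and>
           (case p of (hc, d) \<Rightarrow>
              physically_correct G Vc (resistance len diam rough)
                (merge Vr Vc (hr, hc), q, d))"
proof -
  interpret water_distribution_system G Vr Vc len diam rough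
    by fact
  let ?d = "\<lambda>v\<in>Vc. - (\<Sum>u\<in>neighborhood G v. q (v, u))"
  obtain hc where hc: "hc \<in> vecs Vc" and energy: "energy_conserved (merge Vr Vc (hr, hc)) q"
    using assms(4) by (auto simp: mat_im_def energy_iff_vec_diff_eq)
  have d: "?d \<in> vecs Vc"
    by auto
  show ?thesis
  proof (rule ex1I[of _ "(hc, ?d)"])
    show "(hc, ?d) \<in> vecs Vc \<times> vecs Vc \<and>
        (case (hc, ?d) of (hc, d) \<Rightarrow>
          physically_correct G Vc (resistance len diam rough) (merge Vr Vc (hr, hc), q, d))"
      using hc d energy by (simp only: physically_correct_iff mem_Times_iff fst_conv snd_conv prod.case)
  next
    fix p
    assume p: "p \<in> vecs Vc \<times> vecs Vc \<and>
        (case p of (hc, d) \<Rightarrow>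
          physically_correct G Vc (resistance len diam rough) (merge Vr Vc (hr, hc), q, d))"
    obtain hc' d' where p_eq: "p = (hc', d')"
      by fastforce
    then have "hc' \<in> vecs Vc" and "energy_conserved (merge Vr Vc (hr, hc')) q" and "d' = ?d"
      using p physically_correct_iff[of d'] by auto
    then show "p = (hc, ?d)"
      using consumer_heads_unique[OF _ energy] hc p_eq by simp
  qed
qed

end
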